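(* Let $A$ be an extremally rich C$^*$-algebra. Then the conorm $\gamma(\cdot)$ of $A$ is continuous at a point $a\in A$ if, and only if, either $a$ is not von Neumann regular (i.e. $\gamma(a)=0$) or $a$ is quasi-invertible.
   Context: For a C$^*$-algebra $A$, an element $x\in A$ is quasi-invertible (in the sense of Brown and Pedersen) if there exists $y\in A$ such that $z-xy^*z-zy^*x+xy^*zy^*x=0$ for all $z\in A$, i.e. $(1-xy^* )z(1-y^*x)=0$ for all $z\in A$ (with $1$ the unit of $A$ or of its unitization). $A_q^{-1}$ denotes the set of quasi-invertible elements. A unital C$^*$-algebra $A$ is extremally rich if $A_q^{-1}$ is norm dense in $A$; a non-unital $A$ is extremally rich if its unitization is. The (left) conorm of $a\in A$ is $\gamma(a)=\gamma(L_a)=\inf\left\{\frac{\|ax\|}{\mathrm{dist}(x,\ker(L_a))} : x\in A\setminus\ker(L_a)\right\}\in[0,\infty]$, where $L_a(x)=ax$ for $x\in A$, and $\gamma(0)=\infty$. An element $a\in A$ is von Neumann regular if there is $b\in A$ with $aba=a$. It is known that $a$ is von Neumann regular if and only if $\gamma(a)>0$. *)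

theory Defs
  imports "HOL-Analysis.Analysis"
begin

section \<open>C*-algebras\<close>

text \<open>Not necessarily unital, complex C*-algebras. The real structure inherited from
  \<^class>\<open>real_normed_algebra\<close> is the restriction of the complex one.\<close>

class cstar_algebra = real_normed_algebra + banach +
  fixes scaleC :: "complex \<Rightarrow> 'a \<Rightarrow> 'a" (infixr "*\<^sub>C" 75)
    and star :: "'a \<Rightarrow> 'a" ("_\<^sup>\<star>" [1000] 1000)
  assumes scaleC_of_real: "complex_of_real r *\<^sub>C x = r *\<^sub>R x"
    and scaleC_add_right: "c *\<^sub>C (x + y) = c *\<^sub>C x + c *\<^sub>C y"
    and scaleC_add_left: "(c + d) *\<^sub>C x = c *\<^sub>C x + d *\<^sub>C x"
    and scaleC_scaleC: "c *\<^sub>C d *\<^sub>C x = (c * d) *\<^sub>C x"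
    and scaleC_mult_left: "(c *\<^sub>C x) * y = c *\<^sub>C (x * y)"
    and scaleC_mult_right: "x * (c *\<^sub>C y) = c *\<^sub>C (x * y)"
    and norm_scaleC: "norm (c *\<^sub>C x) = cmod c * norm x"
    and star_star: "(x\<^sup>\<star>)\<^sup>\<star> = x"
    and star_add: "(x + y)\<^sup>\<star> = x\<^sup>\<star> + y\<^sup>\<star>"
    and star_scaleC: "(c *\<^sub>C x)\<^sup>\<star> = cnj c *\<^sub>C x\<^sup>\<star>"
    and star_mult: "(x * y)\<^sup>\<star> = y\<^sup>\<star> * x\<^sup>\<star>"
    and norm_star_mult_self: "norm (x\<^sup>\<star> * x) = (norm x)\<^sup>2"

lemma scaleC_one: "1 *\<^sub>C x = (x :: 'a::cstar_algebra)"
  using scaleC_of_real[of 1 x] by simp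

lemma scaleC_zero_left: "0 *\<^sub>C x = (0 :: 'a::cstar_algebra)"
  using scaleC_of_real[of 0 x] by simp

lemma scaleC_zero_right: "c *\<^sub>C 0 = (0 :: 'a::cstar_algebra)"
  using scaleC_add_right[of c 0 0] by simp

lemma scaleC_scaleR: "c *\<^sub>C r *\<^sub>R x = r *\<^sub>R c *\<^sub>C (x :: 'a::cstar_algebra)"
  by (simp add: scaleC_scaleC mult.commute flip: scaleC_of_real)

lemma norm_star: "norm (x\<^sup>\<star>) = norm (x :: 'a::cstar_algebra)"
proof -
  have *: "norm y \<le> norm (y\<^sup>\<star>)" for y :: 'a
  proof (cases "norm y = 0")
    case False
    have "norm y * norm y \<le> norm (y\<^sup>\<star>) * norm y"
      using norm_mult_ineq[of "y\<^sup>\<star>" y] by (simp add: norm_star_mult_self power2_eq_square)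
    with False show ?thesis by simp
  qed simp
  show ?thesis using *[of x] *[of "x\<^sup>\<star>"] by (simp add: star_star)
qed


section \<open>The unitization\<close>

text \<open>The pair of \<open>a\<close> and \<open>\<lambda>\<close> stands for \<open>a + \<lambda>1\<close>.\<close>

datatype 'a unitization = Unitization (alg_part: 'a) (scalar_part: complex)

text \<open>Left multiplication by an element of the unitization on the ideal \<open>A\<close>.\<close>

definition unitization_act :: "'a::cstar_algebra unitization \<Rightarrow> 'a \<Rightarrow> 'a" where
  "unitization_act u x = alg_part u * x + scalar_part u *\<^sub>C x"

lemma unitization_eqI:
  "alg_part u = alg_part v \<Longrightarrow> scalar_part u = scalar_part v \<Longrightarrow> u = v"
  by (simp add: unitization.expand)

lemma bounded_linear_unitization_act: "bounded_linear (unitization_act u)"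
proof (rule bounded_linear_intro)
  fix x :: 'a
  show "norm (unitization_act u x) \<le> norm x * (norm (alg_part u) + cmod (scalar_part u))"
    unfolding unitization_act_def
    using norm_triangle_ineq[of "alg_part u * x" "scalar_part u *\<^sub>C x"]
      norm_mult_ineq[of "alg_part u" x]
    by (simp add: norm_scaleC algebra_simps)
qed (simp_all add: unitization_act_def scaleC_add_right scaleC_scaleR algebra_simps)

instantiation unitization :: (cstar_algebra) real_algebra
begin

definition "0 = Unitization 0 0"
definition "u + v = Unitization (alg_part u + alg_part v) (scalar_part u + scalar_part v)"
definition "- u = Unitization (- alg_part u) (- scalar_part u)"
definition "u - v = Unitization (alg_part u - alg_part v) (scalar_part u - scalar_part v)"
definition "r *\<^sub>R u = Unitization (r *\<^sub>R alg_part u) (r *\<^sub>R scalar_part u)"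
definition "u * v = Unitization
  (alg_part u * alg_part v + scalar_part u *\<^sub>C alg_part v + scalar_part v *\<^sub>C alg_part u)
  (scalar_part u * scalar_part v)"

instance
  by intro_classes
    (auto intro!: unitization_eqI
      simp: zero_unitization_def plus_unitization_def uminus_unitization_def
        minus_unitization_def scaleR_unitization_def times_unitization_def
        scaleC_add_left scaleC_add_right scaleC_scaleC scaleC_mult_left scaleC_mult_right
        scaleC_scaleR scaleC_one scaleR_conv_of_real algebra_simps simp flip: scaleC_of_real)

end

lemma unitization_parts [simp]:
  "alg_part 0 = 0" "scalar_part 0 = 0"
  "alg_part (u + v) = alg_part u + alg_part v"
  "scalar_part (u + v) = scalar_part u + scalar_part v"
  "alg_part (- u) = - alg_part u" "scalar_part (- u) = - scalar_part u"
  "alg_part (u - v) = alg_part u - alg_part v"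
  "scalar_part (u - v) = scalar_part u - scalar_part v"
  "alg_part (r *\<^sub>R u) = r *\<^sub>R alg_part u"
  "scalar_part (r *\<^sub>R u) = r *\<^sub>R scalar_part u"
  "alg_part (u * v) =
    alg_part u * alg_part v + scalar_part u *\<^sub>C alg_part v + scalar_part v *\<^sub>C alg_part u"
  "scalar_part (u * v) = scalar_part u * scalar_part v"
  by (simp_all add: zero_unitization_def plus_unitization_def uminus_unitization_def
      minus_unitization_def scaleR_unitization_def times_unitization_def)

lemma unitization_act_zero: "unitization_act 0 = (\<lambda>x. 0)"
  by (rule ext) (simp add: unitization_act_def scaleC_zero_left)

lemma unitization_act_add:
  "unitization_act (u + v) = (\<lambda>x. unitization_act u x + unitization_act v x)"
  by (rule ext) (simp add: unitization_act_def scaleC_add_left algebra_simps)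

lemma unitization_act_scaleR:
  "unitization_act (r *\<^sub>R u) = (\<lambda>x. r *\<^sub>R unitization_act u x)"
  by (rule ext) (simp add: unitization_act_def scaleR_conv_of_real scaleC_scaleC scaleC_add_right
      scaleC_mult_left flip: scaleC_of_real)

lemma unitization_act_mult:
  "unitization_act (u * v) = unitization_act u \<circ> unitization_act v"
  by (rule ext) (simp add: unitization_act_def scaleC_scaleC scaleC_add_right scaleC_mult_left
      scaleC_mult_right algebra_simps)

lemma norm_unitization_act_le: "norm (unitization_act u x) \<le> onorm (unitization_act u) * norm x"
  by (rule onorm[OF bounded_linear_unitization_act])

lemma onorm_unitization_act_nonneg: "0 \<le> onorm (unitization_act u)"
  by (rule onorm_pos_le[OF bounded_linear_unitization_act])

lemma onorm_unitization_act_le: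
  "onorm (unitization_act u) \<le> norm (alg_part u) + cmod (scalar_part u)"
proof (rule onorm_bound)
  show "norm (unitization_act u x) \<le> (norm (alg_part u) + cmod (scalar_part u)) * norm x" for x
    unfolding unitization_act_def
    using norm_triangle_ineq[of "alg_part u * x" "scalar_part u *\<^sub>C x"]
      norm_mult_ineq[of "alg_part u" x]
    by (simp add: norm_scaleC algebra_simps)
qed simp

lemma norm_alg_part_le:
  "norm (alg_part u) \<le> onorm (unitization_act u) + cmod (scalar_part u)"
proof (cases "alg_part u = 0")
  case True
  then show ?thesis by (simp add: onorm_unitization_act_nonneg)
next
  case False
  define a where "a = alg_part u"
  have "norm (a * a\<^sup>\<star>) = (norm a)\<^sup>2"
    using norm_star_mult_self[of "a\<^sup>\<star>"] by (simp add: star_star norm_star)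
  moreover have "a * a\<^sup>\<star> = unitization_act u (a\<^sup>\<star>) - scalar_part u *\<^sub>C a\<^sup>\<star>"
    by (simp add: unitization_act_def a_def)
  ultimately have "(norm a)\<^sup>2 \<le> norm (unitization_act u (a\<^sup>\<star>)) + norm (scalar_part u *\<^sub>C a\<^sup>\<star>)"
    by (metis norm_triangle_ineq4)
  also have "\<dots> \<le> (onorm (unitization_act u) + cmod (scalar_part u)) * norm a"
    using norm_unitization_act_le[of u "a\<^sup>\<star>"] by (simp add: norm_star norm_scaleC algebra_simps)
  finally show ?thesis
    using False by (simp add: power2_eq_square a_def)
qed

text \<open>For non-unital \<open>A\<close> the C*-norm of the unitization is the operator norm of the left
  multiplication on \<open>A\<close>, which then dominates the modulus of the scalar part. Taking the maximum
  with that modulus changes nothing in this case, and makes the norm definite, and a C*-norm, for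
  unital \<open>A\<close> as well (where the unitization is isomorphic to the direct sum of \<open>A\<close> and the
  complex numbers).\<close>

instantiation unitization :: (cstar_algebra) real_normed_algebra
begin

definition norm_unitization :: "'a unitization \<Rightarrow> real" where
  "norm u = max (onorm (unitization_act u)) (cmod (scalar_part u))"
definition sgn_unitization :: "'a unitization \<Rightarrow> 'a unitization" where
  "sgn (u :: 'a unitization) = inverse (norm u) *\<^sub>R u"
definition dist_unitization :: "'a unitization \<Rightarrow> 'a unitization \<Rightarrow> real" where
  "dist (u :: 'a unitization) v = norm (u - v)"
definition uniformity_unitization :: "('a unitization \<times> 'a unitization) filter" where
  "uniformity = (INF e\<in>{0<..}. principal {(u :: 'a unitization, v). dist u v < e})"
definition open_unitization :: "'a unitization set \<Rightarrow> bool" where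
  "open (U :: 'a unitization set) \<longleftrightarrow> (\<forall>u\<in>U. \<forall>\<^sub>F (u', v) in uniformity. u' = u \<longrightarrow> v \<in> U)"

instance
proof
  fix u v :: "'a unitization" and r :: real
  show "norm u = 0 \<longleftrightarrow> u = 0"
  proof
    assume "norm u = 0"
    then have "onorm (unitization_act u) \<le> 0" "cmod (scalar_part u) \<le> 0"
      unfolding norm_unitization_def by linarith+
    with norm_alg_part_le[of u] have "norm (alg_part u) \<le> 0" "norm (scalar_part u) \<le> 0"
      by linarith+
    then show "u = 0"
      by (intro unitization_eqI) simp_all
  qed (simp add: norm_unitization_def unitization_act_zero onorm_zero)
  show "norm (u + v) \<le> norm u + norm v"
    using onorm_triangle[OF bounded_linear_unitization_act[of u] bounded_linear_unitization_act[of v]]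
      norm_triangle_ineq[of "scalar_part u" "scalar_part v"]
    by (auto simp: norm_unitization_def unitization_act_add)
  show "norm (r *\<^sub>R u) = \<bar>r\<bar> * norm u"
    by (simp add: norm_unitization_def unitization_act_scaleR
        onorm_scaleR[OF bounded_linear_unitization_act] max_mult_distrib_left)
  have "onorm (unitization_act (u * v)) \<le> onorm (unitization_act u) * onorm (unitization_act v)"
    unfolding unitization_act_mult
    by (rule onorm_compose[OF bounded_linear_unitization_act bounded_linear_unitization_act])
  also have "\<dots> \<le> norm u * norm v"
    unfolding norm_unitization_def
    by (intro mult_mono) (simp_all add: onorm_unitization_act_nonneg le_max_iff_disj)
  finally have "onorm (unitization_act (u * v)) \<le> norm u * norm v" .
  moreover have "cmod (scalar_part (u * v)) \<le> norm u * norm v"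
    unfolding norm_unitization_def unitization_parts norm_mult
    by (intro mult_mono) (simp_all add: le_max_iff_disj)
  ultimately show "norm (u * v) \<le> norm u * norm v"
    by (simp add: norm_unitization_def[of "u * v"])
qed (rule sgn_unitization_def dist_unitization_def uniformity_unitization_def
    open_unitization_def)+

end

instantiation unitization :: (cstar_algebra) cstar_algebra
begin

definition "c *\<^sub>C u = Unitization (c *\<^sub>C alg_part u) (c * scalar_part u)"
definition "u\<^sup>\<star> = Unitization ((alg_part u)\<^sup>\<star>) (cnj (scalar_part u))"

instance
proof
  fix X :: "nat \<Rightarrow> 'a unitization"
  assume X: "Cauchy X"
  have scalar: "cmod (scalar_part u) \<le> norm u" for u :: "'a unitization"
    by (simp add: norm_unitization_def)
  have alg: "norm (alg_part u) \<le> 2 * norm u" for u :: "'a unitization"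
    using norm_alg_part_le[of u] unfolding norm_unitization_def by linarith
  have "bounded_linear (scalar_part :: 'a unitization \<Rightarrow> complex)"
    by (rule bounded_linear_intro[where K = 1]) (auto simp: scalar)
  then have "Cauchy (\<lambda>n. scalar_part (X n))"
    using X by (rule bounded_linear.Cauchy)
  then obtain l where l: "(\<lambda>n. scalar_part (X n)) \<longlonglongrightarrow> l"
    using Cauchy_convergent_iff convergent_def by blast
  have "bounded_linear (alg_part :: 'a unitization \<Rightarrow> 'a)"
    by (rule bounded_linear_intro[where K = 2]) (use alg in \<open>auto simp: mult.commute\<close>)
  then have "Cauchy (\<lambda>n. alg_part (X n))"
    using X by (rule bounded_linear.Cauchy)
  then obtain a where a: "(\<lambda>n. alg_part (X n)) \<longlonglongrightarrow> a"
    using Cauchy_convergent_iff convergent_def by blast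
  have "(\<lambda>n. norm (alg_part (X n) - a) + cmod (scalar_part (X n) - l)) \<longlonglongrightarrow> 0 + 0"
    using a l by (intro tendsto_add tendsto_norm_zero) (simp_all add: LIM_zero)
  moreover have "norm (X n - Unitization a l)
      \<le> norm (alg_part (X n) - a) + cmod (scalar_part (X n) - l)" for n
    using onorm_unitization_act_le[of "X n - Unitization a l"]
    by (simp add: norm_unitization_def)
  ultimately have "(\<lambda>n. X n - Unitization a l) \<longlonglongrightarrow> 0"
    using Lim_null_comparison[OF always_eventually[OF allI]] by fastforce
  then show "convergent X"
    by (rule convergentI[OF LIM_zero_cancel])
next
  fix u v :: "'a unitization" and c d :: complex and r :: real
  show "complex_of_real r *\<^sub>C u = r *\<^sub>R u"
    by (rule unitization_eqI) (simp_all add: scaleC_unitization_def scaleC_of_real scaleR_conv_of_real)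
  show "c *\<^sub>C (u + v) = c *\<^sub>C u + c *\<^sub>C v"
    "(c + d) *\<^sub>C u = c *\<^sub>C u + d *\<^sub>C u"
    "c *\<^sub>C d *\<^sub>C u = (c * d) *\<^sub>C u"
    "(c *\<^sub>C u) * v = c *\<^sub>C (u * v)"
    "u * (c *\<^sub>C v) = c *\<^sub>C (u * v)"
    by (auto intro!: unitization_eqI simp: scaleC_unitization_def scaleC_add_left scaleC_add_right
        scaleC_scaleC scaleC_mult_left scaleC_mult_right algebra_simps)
  show "(u\<^sup>\<star>)\<^sup>\<star> = u" "(u + v)\<^sup>\<star> = u\<^sup>\<star> + v\<^sup>\<star>" "(c *\<^sub>C u)\<^sup>\<star> = cnj c *\<^sub>C u\<^sup>\<star>"
    "(u * v)\<^sup>\<star> = v\<^sup>\<star> * u\<^sup>\<star>" for u v :: "'a unitization"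
    by (auto intro!: unitization_eqI simp: scaleC_unitization_def star_unitization_def star_star
        star_add star_scaleC star_mult algebra_simps)
  have le: "onorm (unitization_act (c *\<^sub>C u)) \<le> cmod c * onorm (unitization_act u)"
    for c and u :: "'a unitization"
  proof (rule onorm_bound)
    fix x :: 'a
    have "unitization_act (c *\<^sub>C u) x = c *\<^sub>C unitization_act u x"
      by (simp add: unitization_act_def scaleC_unitization_def scaleC_mult_left scaleC_add_right
        scaleC_scaleC)
    then show "norm (unitization_act (c *\<^sub>C u) x) \<le> cmod c * onorm (unitization_act u) * norm x"
      using mult_left_mono[OF norm_unitization_act_le[of u x], of "cmod c"]
      by (simp add: norm_scaleC algebra_simps)
  qed (simp add: onorm_unitization_act_nonneg)
  have "onorm (unitization_act (c *\<^sub>C u)) = cmod c * onorm (unitization_act u)"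
  proof (rule antisym[OF le])
    show "cmod c * onorm (unitization_act u) \<le> onorm (unitization_act (c *\<^sub>C u))"
    proof (cases "c = 0")
      case False
      then have "inverse c *\<^sub>C c *\<^sub>C u = u"
        by (intro unitization_eqI) (simp_all add: scaleC_unitization_def scaleC_scaleC scaleC_one)
      with le[of "inverse c" "c *\<^sub>C u"] False show ?thesis
        by (simp add: norm_divide field_simps)
    qed (simp add: onorm_unitization_act_nonneg)
  qed
  then show "norm (c *\<^sub>C u) = cmod c * norm u"
    by (simp add: norm_unitization_def max_mult_distrib_left scaleC_unitization_def norm_mult)
next
  fix u :: "'a unitization"
  have star_star: "(u\<^sup>\<star>)\<^sup>\<star> = u" for u :: "'a unitization"
    by (simp add: star_unitization_def star_star)
  have act_star: "x\<^sup>\<star> * unitization_act (v\<^sup>\<star>) y = (unitization_act v x)\<^sup>\<star> * y"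
    for v :: "'a unitization" and x y :: 'a
    by (simp add: unitization_act_def star_unitization_def star_add star_mult star_scaleC
        scaleC_mult_left scaleC_mult_right algebra_simps)
  have le: "(norm v)\<^sup>2 \<le> norm (v\<^sup>\<star> * v)" for v :: "'a unitization"
  proof -
    let ?K = "onorm (unitization_act (v\<^sup>\<star> * v))"
    have "onorm (unitization_act v) \<le> sqrt ?K"
    proof (rule onorm_bound)
      fix x :: 'a
      have "(norm (unitization_act v x))\<^sup>2 = norm ((unitization_act v x)\<^sup>\<star> * unitization_act v x)"
        by (simp add: norm_star_mult_self)
      also have "\<dots> = norm (x\<^sup>\<star> * unitization_act (v\<^sup>\<star> * v) x)"
        by (simp add: act_star unitization_act_mult)
      also have "\<dots> \<le> norm x * norm (unitization_act (v\<^sup>\<star> * v) x)"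
        using norm_mult_ineq[of "x\<^sup>\<star>"] by (simp add: norm_star)
      also have "\<dots> \<le> norm x * (?K * norm x)"
        by (intro mult_left_mono norm_unitization_act_le) simp
      also have "\<dots> = (sqrt ?K * norm x)\<^sup>2"
        by (simp add: power2_eq_square algebra_simps onorm_unitization_act_nonneg
            flip: real_sqrt_mult)
      finally show "norm (unitization_act v x) \<le> sqrt ?K * norm x"
        by (rule power2_le_imp_le) (simp add: onorm_unitization_act_nonneg)
    qed (simp add: onorm_unitization_act_nonneg)
    then have "(onorm (unitization_act v))\<^sup>2 \<le> ?K"
      using power_mono[of "onorm (unitization_act v)" "sqrt ?K" 2]
      by (simp add: onorm_unitization_act_nonneg)
    moreover have "(cmod (scalar_part v))\<^sup>2 = cmod (scalar_part (v\<^sup>\<star> * v))"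
      by (simp add: star_unitization_def norm_mult power2_eq_square)
    ultimately show ?thesis
      unfolding norm_unitization_def by (auto simp: max_def)
  qed
  have star_le: "norm v \<le> norm (v\<^sup>\<star>)" for v :: "'a unitization"
  proof (cases "norm v = 0")
    case False
    have "norm v * norm v \<le> norm (v\<^sup>\<star>) * norm v"
      using le[of v] norm_mult_ineq[of "v\<^sup>\<star>" v] by (simp add: power2_eq_square)
    with False show ?thesis by simp
  qed simp
  have "norm (u\<^sup>\<star>) = norm u"
    using star_le[of u] star_le[of "u\<^sup>\<star>"] by (simp add: star_star)
  then have "norm (u\<^sup>\<star> * u) \<le> (norm u)\<^sup>2"
    using norm_mult_ineq[of "u\<^sup>\<star>" u] by (simp add: power2_eq_square)
  with le[of u] show "norm (u\<^sup>\<star> * u) = (norm u)\<^sup>2" by simp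
qed

end

lemma norm_Unitization_zero: "norm (Unitization a 0) = norm a"
proof -
  have "onorm (unitization_act (Unitization a 0)) = norm a"
    using norm_alg_part_le[of "Unitization a 0"] onorm_unitization_act_le[of "Unitization a 0"]
    by simp
  then show ?thesis by (simp add: norm_unitization_def)
qed


section \<open>Quasi-invertibility, extremal richness, conorm\<close>

definition quasi_invertible :: "'a::cstar_algebra \<Rightarrow> bool" where
  "quasi_invertible x \<longleftrightarrow>
    (\<exists>y. \<forall>z. z - x * y\<^sup>\<star> * z - z * y\<^sup>\<star> * x + x * y\<^sup>\<star> * z * y\<^sup>\<star> * x = 0)"

definition unital :: "'a::cstar_algebra itself \<Rightarrow> bool" where
  "unital _ \<longleftrightarrow> (\<exists>e::'a. \<forall>x. e * x = x \<and> x * e = x)"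

lemma unital_unitization: "unital TYPE('a::cstar_algebra unitization)"
  unfolding unital_def
  by (rule exI[of _ "Unitization 0 1"])
    (auto intro!: unitization_eqI simp: scaleC_one scaleC_zero_right)

definition extremally_rich :: "'a::cstar_algebra itself \<Rightarrow> bool" where
  "extremally_rich T \<longleftrightarrow>
    (if unital T then closure {x :: 'a. quasi_invertible x} = UNIV
     else closure {x :: 'a unitization. quasi_invertible x} = UNIV)"

definition von_neumann_regular :: "'a::cstar_algebra \<Rightarrow> bool" where
  "von_neumann_regular a \<longleftrightarrow> (\<exists>b. a * b * a = a)"

text \<open>In \<^typ>\<open>ennreal\<close> an empty infimum is \<open>\<infinity>\<close>, and \<open>a\<^sup>\<star>\<close> lies outside the kernel of left
  multiplication by \<open>a \<noteq> 0\<close>, so the infimum is empty exactly for \<open>a = 0\<close>. The kernel is closed, so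
  no denominator vanishes.\<close>

definition conorm :: "'a::cstar_algebra \<Rightarrow> ennreal" where
  "conorm a = (INF x \<in> - {x. a * x = 0}. ennreal (norm (a * x) / infdist x {x. a * x = 0}))"

lemma conorm_zero: "conorm 0 = \<infinity>"
  by (simp add: conorm_def)

end

theory Submission
  imports Defs
begin

text \<open>Von Neumann regular elements are exactly those with \<open>a \<in> aa\<^sup>\<star>A\<close>, and this gives
  \<open>\<gamma>(a) = inf \<parallel>aa\<^sup>\<star>y\<parallel> / \<parallel>a\<^sup>\<star>y\<parallel>\<close> over all \<open>y\<close> with \<open>a\<^sup>\<star>y \<noteq> 0\<close>. An infimum of functions
  that are continuous near \<open>a\<close> is upper semicontinuous, so \<open>\<gamma>\<close> is continuous wherever it vanishes.
  A regular element \<open>a\<close> has a Moore--Penrose inverse \<open>m\<close>, and \<open>\<gamma>(a) = 1 / \<parallel>m\<parallel>\<close>. If \<open>a\<close> is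
  quasi-invertible, i.e. \<open>(1 - am)A(1 - ma) = 0\<close>, then the Schur complement of any nearby \<open>b\<close>
  vanishes, so \<open>(1 + m(b - a))\<^sup>-\<^sup>1m\<close> is an inner inverse of \<open>b\<close> and
  \<open>\<gamma>(b) \<ge> \<gamma>(a) - \<parallel>b - a\<parallel>\<close>. Otherwise choose \<open>0 \<noteq> w \<in> (1 - am)A(1 - ma)\<close>; then
  \<open>\<gamma>(a + \<epsilon>w) \<le> \<epsilon>\<parallel>w\<parallel>\<close> although \<open>\<gamma>(a) > 0\<close>.\<close>

section \<open>Selfadjoint elements bounded below on their range\<close>

lemma star_scaleR: "(r *\<^sub>R x)\<^sup>\<star> = r *\<^sub>R (x\<^sup>\<star> :: 'a::cstar_algebra)"
  by (metis complex_cnj_complex_of_real scaleC_of_real star_scaleC)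

lemma star_minus: "(- x)\<^sup>\<star> = - (x\<^sup>\<star> :: 'a::cstar_algebra)"
  using star_scaleR[of "-1" x] by simp

lemma star_diff: "(x - y)\<^sup>\<star> = x\<^sup>\<star> - (y\<^sup>\<star> :: 'a::cstar_algebra)"
  using star_add[of x "- y"] by (simp add: star_minus)

lemma star_zero: "0\<^sup>\<star> = (0 :: 'a::cstar_algebra)"
  using star_scaleR[of 0 "0 :: 'a"] by simp

lemma bounded_linear_star: "bounded_linear (star :: 'a::cstar_algebra \<Rightarrow> 'a)"
  by (rule bounded_linear_intro[where K = 1]) (simp_all add: star_add star_scaleR norm_star)

lemma norm_mult_star_self: "norm (x * x\<^sup>\<star>) = (norm (x :: 'a::cstar_algebra))\<^sup>2"
  using norm_star_mult_self[of "x\<^sup>\<star>"] by (simp add: star_star norm_star)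

lemma norm_square_selfadjoint:
  fixes x :: "'a::cstar_algebra"
  assumes "x\<^sup>\<star> = x"
  shows "norm (x * x) = (norm x)\<^sup>2"
  using norm_star_mult_self[of x] assms by simp

text \<open>As there may be no unit, invertibility is phrased as unique solvability. Banach's fixed
  point theorem for \<open>\<lambda>x. w - F x\<close> provides it here.\<close>

lemma identity_plus_contraction:
  fixes F :: "'a::banach \<Rightarrow> 'a"
  assumes "linear F" and F: "\<And>x. norm (F x) \<le> c * norm x" and c: "0 \<le> c" "c < 1"
  shows "\<exists>!x. x + F x = w"
proof -
  have "dist (w - F x) (w - F y) \<le> c * dist x y" for x y
    using F[of "y - x"] by (simp add: dist_norm linear_diff[OF \<open>linear F\<close>] norm_minus_commute)
  then have "\<exists>!x. w - F x = x"
    using banach_fix_type[OF c, of "\<lambda>x. w - F x"] by blast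
  moreover have "x + F x = w \<longleftrightarrow> w - F x = x" for x
    by (auto simp: algebra_simps)
  ultimately show ?thesis by simp
qed

text \<open>Arens' trick: write \<open>h + it = (h + is) + i(t - s)\<close>. Since \<open>\<parallel>h + is\<parallel>\<^sup>2 \<le> \<parallel>h\<parallel>\<^sup>2 + s\<^sup>2\<close>
  is less than \<open>(t - s)\<^sup>2\<close> for suitable \<open>s\<close>, the second summand dominates.\<close>

lemma selfadjoint_plus_imaginary:
  fixes h w :: "'a::cstar_algebra"
  assumes h: "h\<^sup>\<star> = h" and "t \<noteq> 0"
  shows "\<exists>!x. h * x + Complex 0 t *\<^sub>C x = w"
proof -
  \<comment> \<open>Solves \<open>- 2 * t * s = (norm h)\<^sup>2 + 1\<close>, so that
    \<open>(t - s)\<^sup>2\<close> exceeds \<open>(norm h)\<^sup>2 + s\<^sup>2\<close>.\<close>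
  define s where "s = - ((norm h)\<^sup>2 + 1) / (2 * t)"
  define G where "G = (\<lambda>x. h * x + Complex 0 s *\<^sub>C x)"
  define \<mu> where "\<mu> = Complex 0 (t - s)"
  have "(t - s)\<^sup>2 = t\<^sup>2 + (norm h)\<^sup>2 + 1 + s\<^sup>2"
    using \<open>t \<noteq> 0\<close> by (simp add: s_def power2_eq_square field_simps)
  then have less: "(norm h)\<^sup>2 + s\<^sup>2 < (t - s)\<^sup>2"
    using zero_le_power2[of t] by linarith
  then have "0 < (t - s)\<^sup>2"
    by (smt (verit) zero_le_power2)
  then have ts: "0 < \<bar>t - s\<bar>"
    by simp
  have mu: "\<mu> \<noteq> 0" "cmod \<mu> = \<bar>t - s\<bar>"
    using ts by (auto simp: \<mu>_def complex_eq_iff cmod_def)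
  have G: "norm (G x) \<le> sqrt ((norm h)\<^sup>2 + s\<^sup>2) * norm x" for x
  proof (rule power2_le_imp_le)
    have c: "Complex 0 (- s) * Complex 0 s = complex_of_real (s\<^sup>2)"
      by (simp add: complex_eq_iff power2_eq_square)
    have cnj: "cnj (Complex 0 s) = Complex 0 (- s)"
      by (simp add: complex_eq_iff)
    have "Complex 0 s + Complex 0 (- s) = 0"
      by (simp add: complex_eq_iff)
    then have "Complex 0 (- s) *\<^sub>C y = - (Complex 0 s *\<^sub>C y)" for y :: 'a
      by (metis add_eq_0_iff scaleC_add_left scaleC_zero_left)
    then have "(G x)\<^sup>\<star> * G x = x\<^sup>\<star> * (h * h * x) + s\<^sup>2 *\<^sub>R (x\<^sup>\<star> * x)"
      unfolding G_def star_add star_mult star_scaleC h cnj distrib_left distrib_right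
        scaleC_mult_left scaleC_mult_right scaleC_scaleC scaleC_add_right
        mult.commute[of "Complex 0 s"] c scaleC_of_real
      by (simp add: mult.assoc)
    then have "(norm (G x))\<^sup>2 \<le> norm (x\<^sup>\<star> * (h * h * x)) + s\<^sup>2 * (norm x)\<^sup>2"
      using norm_triangle_ineq[of "x\<^sup>\<star> * (h * h * x)" "s\<^sup>2 *\<^sub>R (x\<^sup>\<star> * x)"]
      by (simp add: norm_star_mult_self[symmetric, of "G x"]) (simp add: norm_star_mult_self)
    also have "norm (x\<^sup>\<star> * (h * h * x)) = (norm (h * x))\<^sup>2"
      using norm_star_mult_self[of "h * x"] by (simp add: star_mult h mult.assoc)
    also have "\<dots> \<le> (norm h * norm x)\<^sup>2"
      by (intro power_mono norm_mult_ineq) simp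
    finally show "(norm (G x))\<^sup>2 \<le> (sqrt ((norm h)\<^sup>2 + s\<^sup>2) * norm x)\<^sup>2"
      by (simp add: power_mult_distrib algebra_simps)
  qed simp
  have "linear G"
    unfolding G_def by (intro linearI) (simp_all add: scaleC_add_right scaleC_scaleR algebra_simps)
  then have "linear (\<lambda>x. inverse \<mu> *\<^sub>C G x)"
    by (intro linearI) (simp_all add: linear_add linear_scale scaleC_add_right scaleC_scaleR)
  moreover have "norm (inverse \<mu> *\<^sub>C G x) \<le> sqrt ((norm h)\<^sup>2 + s\<^sup>2) / \<bar>t - s\<bar> * norm x" for x
    using divide_right_mono[OF G[of x], of "\<bar>t - s\<bar>"] ts
    by (simp add: norm_scaleC norm_inverse mu(2) divide_inverse algebra_simps)
  moreover have "sqrt ((norm h)\<^sup>2 + s\<^sup>2) / \<bar>t - s\<bar> < 1"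
    using real_sqrt_less_mono[OF less] ts by simp
  ultimately have "\<exists>!x. x + inverse \<mu> *\<^sub>C G x = inverse \<mu> *\<^sub>C w"
    by (intro identity_plus_contraction) auto
  moreover have "x + inverse \<mu> *\<^sub>C G x = inverse \<mu> *\<^sub>C w \<longleftrightarrow> h * x + Complex 0 t *\<^sub>C x = w" for x
  proof -
    have cancel: "c *\<^sub>C y = c *\<^sub>C z \<longleftrightarrow> y = z" if "c \<noteq> 0" for c and y z :: 'a
      using that by (metis left_inverse scaleC_one scaleC_scaleC)
    have "x + inverse \<mu> *\<^sub>C G x = inverse \<mu> *\<^sub>C (\<mu> *\<^sub>C x + G x)"
      using mu by (simp add: scaleC_add_right scaleC_scaleC scaleC_one)
    also have "\<mu> *\<^sub>C x + G x = h * x + (\<mu> + Complex 0 s) *\<^sub>C x"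
      by (simp add: G_def scaleC_add_left)
    also have "\<mu> + Complex 0 s = Complex 0 t"
      by (simp add: \<mu>_def complex_eq_iff)
    finally show ?thesis
      using mu by (simp add: cancel)
  qed
  ultimately show ?thesis by simp
qed

text \<open>\<open>h\<^sup>2 + \<tau>\<close> factors as
  \<open>(h + i sqrt \<tau>)(h - i sqrt \<tau>)\<close>, and both factors act bijectively.\<close>

lemma selfadjoint_square_plus_pos:
  fixes h w :: "'a::cstar_algebra"
  assumes h: "h\<^sup>\<star> = h" and "\<tau> > 0"
  shows "\<exists>!x. h * h * x + \<tau> *\<^sub>R x = w"
proof -
  let ?c = "Complex 0 (sqrt \<tau>)" and ?d = "Complex 0 (- sqrt \<tau>)"
  have cd: "?d + ?c = 0" "?c * ?d = complex_of_real \<tau>"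
    using \<open>\<tau> > 0\<close> by (simp_all add: complex_eq_iff)
  have factor: "h * h * x + \<tau> *\<^sub>R x = h * (h * x + ?d *\<^sub>C x) + ?c *\<^sub>C (h * x + ?d *\<^sub>C x)" for x
  proof -
    have "?d *\<^sub>C (h * x) + ?c *\<^sub>C (h * x) = 0"
      by (metis cd(1) scaleC_add_left scaleC_zero_left)
    then show ?thesis
      by (simp add: distrib_left scaleC_add_right scaleC_mult_right scaleC_scaleC cd
          scaleC_of_real mult.assoc add.assoc)
  qed
  have ex: "\<exists>!x. h * x + ?c *\<^sub>C x = w" "\<exists>!x. h * x + ?d *\<^sub>C x = w" for w
    using selfadjoint_plus_imaginary[OF h] \<open>\<tau> > 0\<close> by simp_all
  show ?thesis
    unfolding factor using ex by metis
qed

lemma regularized_inverse: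
  fixes h :: "'a::cstar_algebra"
  assumes h: "h\<^sup>\<star> = h" and "\<tau> > 0"
  obtains g where "h * h * g + \<tau> *\<^sub>R g = h" "g\<^sup>\<star> = g" "h * g = g * h"
proof -
  obtain g where g: "h * h * g + \<tau> *\<^sub>R g = h"
    using selfadjoint_square_plus_pos[OF h \<open>\<tau> > 0\<close>] by blast
  \<comment> \<open>\<open>h * g\<close> and \<open>g * h\<close> solve the same equation with right
    side \<open>h * h\<close>, so uniqueness makes them equal.\<close>
  have "h * h * (h * g) + \<tau> *\<^sub>R (h * g) = h * (h * h * g + \<tau> *\<^sub>R g)"
    by (simp add: algebra_simps)
  moreover have "h * h * (g * h) + \<tau> *\<^sub>R (g * h) = (h * h * g + \<tau> *\<^sub>R g) * h"
    by (simp add: algebra_simps)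
  ultimately have comm: "h * g = g * h"
    using selfadjoint_square_plus_pos[OF h \<open>\<tau> > 0\<close>, of "h * h"] g by auto
  have g': "g\<^sup>\<star> * h * h + \<tau> *\<^sub>R g\<^sup>\<star> = h"
    using arg_cong[OF g, of star] by (simp add: star_add star_mult star_scaleR h mult.assoc)
  have "h * g = (g\<^sup>\<star> * h * h + \<tau> *\<^sub>R g\<^sup>\<star>) * g"
    by (simp add: g')
  also have "\<dots> = g\<^sup>\<star> * (h * h * g + \<tau> *\<^sub>R g)"
    by (simp add: algebra_simps)
  finally have "h * g = g\<^sup>\<star> * h"
    by (simp add: g)
  then have "h * h * g = g\<^sup>\<star> * h * h"
    using comm by (metis mult.assoc)
  with g g' have "\<tau> *\<^sub>R g\<^sup>\<star> = \<tau> *\<^sub>R g"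
    by (metis add_left_imp_eq)
  with \<open>\<tau> > 0\<close> have "g\<^sup>\<star> = g" by simp
  with g comm show thesis using that by blast
qed

text \<open>The regularized inverses \<open>g\<^sub>\<tau> = h(h\<^sup>2 + \<tau>)\<^sup>-\<^sup>1\<close> converge as \<open>\<tau> \<rightarrow> 0\<close>: the hypothesis passes
  from \<open>hA\<close> to \<open>g\<^sub>\<tau>\<close>, because \<open>g\<^sub>\<tau>A \<subseteq> hA\<close>, and bounds \<open>\<parallel>g\<^sub>\<tau>\<parallel>\<close> uniformly.\<close>

lemma selfadjoint_bounded_below:
  fixes h :: "'a::cstar_algebra"
  assumes h: "h\<^sup>\<star> = h" and "K > 0" and below: "\<And>y. norm (h * y) \<le> K * norm (h * (h * y))"
  shows "\<exists>g. h = h * h * g"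
proof -
  \<comment> \<open>The scaling keeps \<open>\<tau> n * K\<^sup>2\<close> at most
    \<open>1 / 2\<close>, which absorbs a quadratic term when \<open>h * g n\<close> is
    bounded.\<close>
  define \<tau> where "\<tau> n = 1 / (2 * K\<^sup>2) * inverse (real (Suc n))" for n
  have pos: "\<tau> n > 0" for n
    using \<open>K > 0\<close> by (simp add: \<tau>_def)
  have small: "\<tau> n * K\<^sup>2 \<le> 1 / 2" for n
    using \<open>K > 0\<close> inverse_le_1_iff[of "real (Suc n)"] by (simp add: \<tau>_def)
  have "\<tau> \<longlonglongrightarrow> 1 / (2 * K\<^sup>2) * 0"
    unfolding \<tau>_def by (intro tendsto_mult tendsto_const LIMSEQ_inverse_real_of_nat)
  then have lim: "\<tau> \<longlonglongrightarrow> 0" by simp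
  have "\<forall>n. \<exists>g. h * h * g + \<tau> n *\<^sub>R g = h \<and> g\<^sup>\<star> = g \<and> h * g = g * h"
    using regularized_inverse[OF h pos] by metis
  then obtain g where g: "h * h * g n + \<tau> n *\<^sub>R g n = h" "(g n)\<^sup>\<star> = g n" "h * g n = g n * h" for n
    by metis
  have range: "\<exists>y. g n * w = h * y" for n w
  proof
    have "h * h * g n * w + \<tau> n *\<^sub>R (g n * w) = h * w"
      using arg_cong[OF g(1)[of n], of "\<lambda>x. x * w"] by (simp add: distrib_right)
    then have "\<tau> n *\<^sub>R (g n * w) = h * (w - h * g n * w)"
      by (simp add: algebra_simps)
    then show "g n * w = h * ((1 / \<tau> n) *\<^sub>R (w - h * g n * w))"
      using pos[of n] by (metis (no_types, lifting) divide_self_if less_irrefl mult_scaleR_right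
          scaleR_one scaleR_scaleR times_divide_eq_left mult_1)
  qed
  \<comment> \<open>The second premise puts \<open>x * x\<close> into \<open>hA\<close>, where the
    hypothesis applies; selfadjointness makes its norm a square, and one factor cancels.\<close>
  have below': "norm x \<le> K * norm (h * x)" if "x\<^sup>\<star> = x" "\<And>w. \<exists>y. x * w = h * y" for x
  proof (cases "x = 0")
    case False
    have "(norm x)\<^sup>2 = norm (x * x)"
      by (simp add: norm_square_selfadjoint that)
    also have "\<dots> \<le> K * norm (h * (x * x))"
      using that(2)[of x] below by metis
    also have "\<dots> \<le> K * (norm (h * x) * norm x)"
      using \<open>K > 0\<close> norm_mult_ineq[of "h * x" x] by (simp add: mult.assoc)
    finally show ?thesis
      using False by (simp add: power2_eq_square)
  qed simp
  have gK: "norm (g n) \<le> K * norm (h * g n)" for n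
    using below'[OF g(2) range] .
  \<comment> \<open>\<open>N = h * g n\<close> is almost idempotent,
    \<open>N\<^sup>2 = N - \<tau> n *\<^sub>R (g n)\<^sup>2\<close>. Together with \<open>gK\<close>
    this bounds \<open>norm N\<close> by 2.\<close>
  have bound: "norm (g n) \<le> 2 * K" for n
  proof -
    let ?N = "h * g n"
    have sa: "?N\<^sup>\<star> = ?N"
      by (simp add: star_mult g h)
    have "?N * ?N = (h * h * g n) * g n"
      by (metis g(3) mult.assoc)
    also have "\<dots> = ?N - \<tau> n *\<^sub>R (g n * g n)"
      using arg_cong[OF g(1)[of n], of "\<lambda>x. x * g n"] by (simp add: algebra_simps)
    finally have "(norm ?N)\<^sup>2 = norm (?N - \<tau> n *\<^sub>R (g n * g n))"
      using norm_square_selfadjoint[OF sa] by simp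
    also have "\<dots> \<le> norm ?N + \<tau> n * (norm (g n))\<^sup>2"
      using norm_triangle_ineq4[of ?N "\<tau> n *\<^sub>R (g n * g n)"] pos[of n]
      by (simp add: norm_square_selfadjoint g)
    also have "\<dots> \<le> norm ?N + \<tau> n * (K * norm ?N)\<^sup>2"
      using pos[of n] gK[of n] by (intro add_left_mono mult_left_mono power_mono) auto
    also have "\<dots> = norm ?N + (\<tau> n * K\<^sup>2) * (norm ?N)\<^sup>2"
      by (simp add: power_mult_distrib)
    also have "\<dots> \<le> norm ?N + 1 / 2 * (norm ?N)\<^sup>2"
      by (intro add_left_mono mult_right_mono small) simp
    finally have "norm ?N * (norm ?N - 2) \<le> 0"
      by (simp add: power2_eq_square algebra_simps)
    then have "norm ?N \<le> 2"
      by (auto simp: mult_le_0_iff)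
    with \<open>K > 0\<close> have "K * norm ?N \<le> K * 2" by (intro mult_left_mono) auto
    with gK[of n] show ?thesis by linarith
  qed
  \<comment> \<open>A resolvent identity: \<open>h(g n - g m)\<close> is
    \<open>\<tau> m - \<tau> n\<close> times \<open>g n * g m\<close>. The constant is
    \<open>K * (2 * K)\<^sup>2\<close>.\<close>
  have diff: "norm (g n - g m) \<le> 4 * K ^ 3 * \<bar>\<tau> m - \<tau> n\<bar>" for n m
  proof -
    have "h * h * (g n - g m) + \<tau> n *\<^sub>R (g n - g m)
        = (h * h * g n + \<tau> n *\<^sub>R g n) - (h * h * g m + \<tau> m *\<^sub>R g m) + (\<tau> m - \<tau> n) *\<^sub>R g m"
      by (simp add: algebra_simps)
    then have eq: "h * h * (g n - g m) + \<tau> n *\<^sub>R (g n - g m) = (\<tau> m - \<tau> n) *\<^sub>R g m"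
      by (simp add: g)
    have "g n * h * h + \<tau> n *\<^sub>R g n = h"
      using g(1,3)[of n] by (metis mult.assoc)
    then have "h * (g n - g m) = (g n * h * h + \<tau> n *\<^sub>R g n) * (g n - g m)"
      by simp
    also have "\<dots> = g n * (h * h * (g n - g m) + \<tau> n *\<^sub>R (g n - g m))"
      by (simp add: algebra_simps)
    finally have "h * (g n - g m) = (\<tau> m - \<tau> n) *\<^sub>R (g n * g m)"
      by (simp add: eq)
    then have "norm (h * (g n - g m)) \<le> \<bar>\<tau> m - \<tau> n\<bar> * (norm (g n) * norm (g m))"
      by (simp add: mult_left_mono norm_mult_ineq)
    also have "\<dots> \<le> \<bar>\<tau> m - \<tau> n\<bar> * ((2 * K) * (2 * K))"
      using \<open>K > 0\<close> by (intro mult_left_mono mult_mono bound) auto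
    finally have "K * norm (h * (g n - g m)) \<le> K * (\<bar>\<tau> m - \<tau> n\<bar> * ((2 * K) * (2 * K)))"
      using \<open>K > 0\<close> by (intro mult_left_mono) auto
    moreover have "\<exists>y. (g n - g m) * w = h * y" for w
      using range[of n w] range[of m w] by (metis left_diff_distrib right_diff_distrib)
    then have "norm (g n - g m) \<le> K * norm (h * (g n - g m))"
      by (intro below') (simp_all add: star_diff g)
    ultimately show ?thesis
      by (simp add: power3_eq_cube algebra_simps)
  qed
  have "Cauchy g"
  proof (rule metric_CauchyI)
    fix e :: real assume "e > 0"
    then have "e / (4 * K ^ 3) > 0" using \<open>K > 0\<close> by simp
    then obtain M where M: "\<forall>m\<ge>M. \<forall>n\<ge>M. dist (\<tau> m) (\<tau> n) < e / (4 * K ^ 3)"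
      using metric_CauchyD[OF LIMSEQ_imp_Cauchy[OF lim]] by blast
    show "\<exists>M. \<forall>m\<ge>M. \<forall>n\<ge>M. dist (g m) (g n) < e"
    proof (intro exI allI impI)
      fix m n assume "m \<ge> M" "n \<ge> M"
      with M have "\<bar>\<tau> n - \<tau> m\<bar> < e / (4 * K ^ 3)" by (simp add: dist_real_def abs_minus_commute)
      then have "4 * K ^ 3 * \<bar>\<tau> n - \<tau> m\<bar> < e"
        using \<open>K > 0\<close> by (simp add: field_simps)
      with diff[of m n] show "dist (g m) (g n) < e" by (simp add: dist_norm)
    qed
  qed
  then obtain l where l: "g \<longlonglongrightarrow> l"
    using Cauchy_convergent_iff convergent_def by blast
  have "(\<lambda>n. h * h * g n + \<tau> n *\<^sub>R g n) \<longlonglongrightarrow> h * h * l + 0 *\<^sub>R l"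
    by (intro tendsto_intros l lim)
  then have "(\<lambda>n. h) \<longlonglongrightarrow> h * h * l"
    by (simp add: g)
  then show ?thesis
    using LIMSEQ_unique tendsto_const by blast
qed

text \<open>For \<open>h = a * a\<^sup>\<star>\<close> the selfadjoint case gives
  \<open>h = h * h * g\<close>; the C*-identity then strips one factor \<open>a\<close>, leaving
  \<open>a\<^sup>\<star> = a\<^sup>\<star> * h * g\<close>.\<close>

lemma bounded_below_factor:
  fixes a :: "'a::cstar_algebra"
  assumes below: "\<And>y. norm (a\<^sup>\<star> * y) \<le> C * norm (a * a\<^sup>\<star> * y)"
  shows "\<exists>c. a = a * a\<^sup>\<star> * c"
proof -
  define K where "K = max C 1"
  have K: "K > 0" "norm (a\<^sup>\<star> * y) \<le> K * norm (a * (a\<^sup>\<star> * y))" for y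
  proof -
    have "C * norm (a * a\<^sup>\<star> * y) \<le> K * norm (a * a\<^sup>\<star> * y)"
      by (intro mult_right_mono) (simp_all add: K_def)
    with below[of y] show "norm (a\<^sup>\<star> * y) \<le> K * norm (a * (a\<^sup>\<star> * y))"
      by (simp add: mult.assoc)
  qed (simp add: K_def)
  define h where "h = a * a\<^sup>\<star>"
  have h: "h\<^sup>\<star> = h"
    by (simp add: h_def star_mult star_star)
  have "norm (h * y) \<le> (K * K) * norm (h * (h * y))" for y
  proof (cases "h * y = 0")
    case False
    have "(norm (h * y))\<^sup>2 = norm ((a\<^sup>\<star> * y)\<^sup>\<star> * (a\<^sup>\<star> * (h * y)))"
      using norm_star_mult_self[of "h * y"] by (simp add: h_def star_mult star_star mult.assoc)
    also have "\<dots> \<le> norm (a\<^sup>\<star> * y) * norm (a\<^sup>\<star> * (h * y))"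
      using norm_mult_ineq[of "(a\<^sup>\<star> * y)\<^sup>\<star>"] by (simp add: norm_star)
    also have "\<dots> \<le> (K * norm (h * y)) * (K * norm (h * (h * y)))"
      using K(2)[of y] K(2)[of "h * y"] K(1) by (intro mult_mono) (simp_all add: h_def mult.assoc)
    finally show ?thesis
      using False by (simp add: power2_eq_square)
  qed simp
  then obtain g where g: "h = h * h * g"
    using selfadjoint_bounded_below[OF h, of "K * K"] \<open>K > 0\<close> by auto
  then have g': "h = g\<^sup>\<star> * h * h"
    by (metis h mult.assoc star_mult)
  have comm: "h * g = g\<^sup>\<star> * h"
    by (metis g g' mult.assoc)
  have "(a\<^sup>\<star> - a\<^sup>\<star> * h * g)\<^sup>\<star> * (a\<^sup>\<star> - a\<^sup>\<star> * h * g)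
      = h - h * h * g - g\<^sup>\<star> * h * h + g\<^sup>\<star> * h * h * h * g"
    by (simp add: star_diff star_mult star_star h left_diff_distrib right_diff_distrib mult.assoc)
      (simp add: h_def mult.assoc)
  also have "\<dots> = 0"
    by (simp flip: g g')
  finally have "a\<^sup>\<star> = a\<^sup>\<star> * h * g"
    using norm_star_mult_self[of "a\<^sup>\<star> - a\<^sup>\<star> * h * g"] by simp
  then have "a = g\<^sup>\<star> * h * a"
    by (metis h mult.assoc star_mult star_star)
  also have "\<dots> = a * a\<^sup>\<star> * (g * a)"
    by (simp flip: comm) (simp add: h_def mult.assoc)
  finally show ?thesis ..
qed

section \<open>The conorm and regularity\<close>

text \<open>If \<open>x = b\<^sup>\<star>y\<close> and \<open>bk = 0\<close>, then \<open>x\<^sup>\<star>(x - k) = x\<^sup>\<star>x\<close>, so \<open>\<parallel>x\<parallel> \<le> \<parallel>x - k\<parallel>\<close>.\<close>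

lemma infdist_kernel_star:
  fixes b y :: "'a::cstar_algebra"
  shows "infdist (b\<^sup>\<star> * y) {x. b * x = 0} = norm (b\<^sup>\<star> * y)"
proof (rule antisym)
  show "infdist (b\<^sup>\<star> * y) {x. b * x = 0} \<le> norm (b\<^sup>\<star> * y)"
    by (rule infdist_le2[of 0]) simp_all
  have "norm (b\<^sup>\<star> * y) \<le> dist (b\<^sup>\<star> * y) k" if "b * k = 0" for k
  proof (cases "b\<^sup>\<star> * y = 0")
    case False
    have "(b\<^sup>\<star> * y)\<^sup>\<star> * (b\<^sup>\<star> * y - k) = (b\<^sup>\<star> * y)\<^sup>\<star> * (b\<^sup>\<star> * y)"
      using that by (simp add: star_mult star_star right_diff_distrib mult.assoc)
    then have "(norm (b\<^sup>\<star> * y))\<^sup>2 = norm ((b\<^sup>\<star> * y)\<^sup>\<star> * (b\<^sup>\<star> * y - k))"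
      by (simp only: norm_star_mult_self)
    also have "\<dots> \<le> norm (b\<^sup>\<star> * y) * norm (b\<^sup>\<star> * y - k)"
      using norm_mult_ineq[of "(b\<^sup>\<star> * y)\<^sup>\<star>"] by (simp add: norm_star)
    finally show ?thesis
      using False by (simp add: power2_eq_square dist_norm)
  qed simp
  moreover have "{x. b * x = 0} \<noteq> {}"
    using mult_zero_right by blast
  ultimately show "norm (b\<^sup>\<star> * y) \<le> infdist (b\<^sup>\<star> * y) {x. b * x = 0}"
    unfolding infdist_def by (auto intro: cINF_greatest)
qed

lemma star_mult_eq_0_iff:
  fixes b y :: "'a::cstar_algebra"
  shows "b * (b\<^sup>\<star> * y) = 0 \<longleftrightarrow> b\<^sup>\<star> * y = 0"
proof
  assume "b * (b\<^sup>\<star> * y) = 0"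
  then have "norm ((b\<^sup>\<star> * y)\<^sup>\<star> * (b\<^sup>\<star> * y)) = 0"
    by (simp add: star_mult star_star mult.assoc)
  then show "b\<^sup>\<star> * y = 0"
    by (simp add: norm_star_mult_self)
qed simp

text \<open>Vectors \<open>b\<^sup>\<star> * y\<close> are convenient tests: their distance to the
  kernel is their norm, so the quotient depends continuously on \<open>b\<close> while they are
  nonzero.\<close>

lemma conorm_le:
  fixes b y :: "'a::cstar_algebra"
  assumes "b\<^sup>\<star> * y \<noteq> 0"
  shows "conorm b \<le> ennreal (norm (b * (b\<^sup>\<star> * y)) / norm (b\<^sup>\<star> * y))"
  unfolding conorm_def
  by (rule INF_lower2[of "b\<^sup>\<star> * y"]) (simp_all add: assms star_mult_eq_0_iff infdist_kernel_star)


lemma infdist_kernel_pos: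
  fixes a x :: "'a::real_normed_algebra"
  assumes "a * x \<noteq> 0"
  shows "infdist x {x. a * x = 0} > 0"
proof -
  have "closed {x. a * x = 0}"
    by (intro closed_Collect_eq continuous_intros)
  moreover have "{x. a * x = 0} \<noteq> {}"
    using mult_zero_right by blast
  ultimately have "infdist x {x. a * x = 0} \<noteq> 0"
    using assms by (simp flip: in_closed_iff_infdist_zero)
  then show ?thesis
    using infdist_nonneg[of x "{x. a * x = 0}"] by linarith
qed

text \<open>\<open>x - b * (a * x)\<close> lies in the kernel, so \<open>x\<close> has distance at
  most \<open>norm b * norm (a * x)\<close> from it. A separate positive \<open>M\<close> avoids
  dividing by zero when \<open>b = 0\<close>.\<close>

lemma conorm_ge_inner_inverse:
  fixes a b :: "'a::cstar_algebra"
  assumes "a * b * a = a" and "norm b \<le> M" and "M > 0"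
  shows "ennreal (1 / M) \<le> conorm a"
  unfolding conorm_def
proof (rule INF_greatest)
  fix x assume x: "x \<in> - {x. a * x = 0}"
  have "infdist x {x. a * x = 0} \<le> dist x (x - b * (a * x))"
    using assms(1) by (intro infdist_le) (simp add: right_diff_distrib flip: mult.assoc)
  also have "\<dots> \<le> norm b * norm (a * x)"
    by (simp add: dist_norm norm_mult_ineq)
  also have "\<dots> \<le> M * norm (a * x)"
    using assms(2) by (intro mult_right_mono) auto
  finally show "ennreal (1 / M) \<le> ennreal (norm (a * x) / infdist x {x. a * x = 0})"
    using infdist_kernel_pos[of a x] x \<open>M > 0\<close> by (intro ennreal_leI) (simp add: field_simps)
qed

lemma conorm_lower_bound_factor:
  fixes a :: "'a::cstar_algebra"
  assumes "c > 0"
    and ge: "\<And>y. a\<^sup>\<star> * y \<noteq> 0 \<Longrightarrow> c \<le> ennreal (norm (a * (a\<^sup>\<star> * y)) / norm (a\<^sup>\<star> * y))"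
  shows "\<exists>d. a = a * a\<^sup>\<star> * d"
proof -
  obtain z where z: "0 < z" "z < c"
    using dense[OF \<open>c > 0\<close>] by blast
  then obtain r where r: "z = ennreal r" "r \<ge> 0"
    by (cases z) (auto simp: top_unique)
  with z have "r > 0" by simp
  have "norm (a\<^sup>\<star> * y) \<le> (1 / r) * norm (a * a\<^sup>\<star> * y)" for y
  proof (cases "a\<^sup>\<star> * y = 0")
    case False
    then have "ennreal r \<le> ennreal (norm (a * (a\<^sup>\<star> * y)) / norm (a\<^sup>\<star> * y))"
      using ge[of y] z(2) r(1) by (meson less_le_trans less_imp_le)
    then have "r \<le> norm (a * (a\<^sup>\<star> * y)) / norm (a\<^sup>\<star> * y)"
      by (simp add: ennreal_le_iff)
    then show ?thesis
      using False \<open>r > 0\<close> by (simp add: field_simps)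
  qed (use \<open>r > 0\<close> in simp)
  then show ?thesis
    by (rule bounded_below_factor)
qed

text \<open>A converse to \<open>conorm_le\<close>: if all these test quotients were at least
  \<open>c\<close>, then \<open>a = a * a\<^sup>\<star> * d\<close>, and every \<open>x\<close>
  could be replaced by \<open>a\<^sup>\<star> * d * x\<close>, which has the same image under
  \<open>a\<close>.\<close>

lemma conorm_less_imp:
  fixes a :: "'a::cstar_algebra"
  assumes "conorm a < c"
  shows "\<exists>y. a\<^sup>\<star> * y \<noteq> 0 \<and> ennreal (norm (a * (a\<^sup>\<star> * y)) / norm (a\<^sup>\<star> * y)) < c"
proof (rule ccontr)
  assume "\<not> ?thesis"
  then have ge: "c \<le> ennreal (norm (a * (a\<^sup>\<star> * y)) / norm (a\<^sup>\<star> * y))" if "a\<^sup>\<star> * y \<noteq> 0" for y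
    using that by (meson linorder_not_less)
  have "c > 0"
    using assms by (rule le_less_trans[rotated]) simp
  then obtain d where d: "a = a * a\<^sup>\<star> * d"
    using conorm_lower_bound_factor ge by blast
  have "c \<le> conorm a"
    unfolding conorm_def
  proof (rule INF_greatest)
    fix x assume x: "x \<in> - {x. a * x = 0}"
    define y where "y = d * x"
    have ax: "a * (a\<^sup>\<star> * y) = a * x"
      using d by (metis y_def mult.assoc)
    with x have y: "a\<^sup>\<star> * y \<noteq> 0" by auto
    have "infdist x {x. a * x = 0} \<le> norm (a\<^sup>\<star> * y)"
      using ax by (intro infdist_le2[of "x - a\<^sup>\<star> * y"]) (auto simp: dist_norm right_diff_distrib)
    then have "norm (a * x) / norm (a\<^sup>\<star> * y) \<le> norm (a * x) / infdist x {x. a * x = 0}"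
      using infdist_kernel_pos[of a x] x by (intro divide_left_mono) (use y in auto)
    with ge[OF y] show "c \<le> ennreal (norm (a * x) / infdist x {x. a * x = 0})"
      unfolding ax by (meson ennreal_leI order_trans)
  qed
  with assms show False by simp
qed

text \<open>Taking adjoints in \<open>a = a * a\<^sup>\<star> * c\<close> shows that
  \<open>c\<^sup>\<star>\<close> is an inner inverse.\<close>

lemma conorm_pos_iff_regular:
  fixes a :: "'a::cstar_algebra"
  shows "conorm a > 0 \<longleftrightarrow> von_neumann_regular a"
proof
  assume "conorm a > 0"
  then obtain c where c: "a = a * a\<^sup>\<star> * c"
    using conorm_lower_bound_factor conorm_le by blast
  then have "a\<^sup>\<star> = c\<^sup>\<star> * (a * a\<^sup>\<star>)"
    by (metis star_mult star_star)
  then have "a * c\<^sup>\<star> * a = a"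
    using c by (metis mult.assoc)
  then show "von_neumann_regular a"
    by (auto simp: von_neumann_regular_def)
next
  assume "von_neumann_regular a"
  then obtain b where "a * b * a = a"
    by (auto simp: von_neumann_regular_def)
  then have "ennreal (1 / (norm b + 1)) \<le> conorm a"
    by (rule conorm_ge_inner_inverse) (simp_all add: add_nonneg_pos)
  moreover have "0 < ennreal (1 / (norm b + 1))"
    by (simp add: add_nonneg_pos)
  ultimately show "conorm a > 0"
    by (rule less_le_trans[rotated])
qed

section \<open>The Moore-Penrose inverse\<close>

lemma regular_imp_factor:
  fixes a :: "'a::cstar_algebra"
  assumes "von_neumann_regular a"
  shows "\<exists>c. a = a * a\<^sup>\<star> * c"
  using conorm_lower_bound_factor conorm_le assms conorm_pos_iff_regular by blast

lemma regular_star: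
  fixes a :: "'a::cstar_algebra"
  assumes "von_neumann_regular a"
  shows "von_neumann_regular (a\<^sup>\<star>)"
  using assms unfolding von_neumann_regular_def by (metis mult.assoc star_mult)

text \<open>The factorizations of \<open>a\<close> and of its adjoint yield the support projection
  \<open>q\<close> and the range projection \<open>p\<close>; then
  \<open>m = c\<^sup>\<star> * a * d\<close> satisfies \<open>a * m = p\<close> and
  \<open>m * a = q\<close>.\<close>

lemma moore_penrose_inverse:
  fixes a :: "'a::cstar_algebra"
  assumes "von_neumann_regular a"
  obtains m where "a * m * a = a" "m * a * m = m" "(a * m)\<^sup>\<star> = a * m" "(m * a)\<^sup>\<star> = m * a"
proof -
  obtain c where c: "a = a * a\<^sup>\<star> * c"
    using regular_imp_factor[OF assms] by blast
  obtain d where d: "a\<^sup>\<star> = a\<^sup>\<star> * a * d"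
    using regular_imp_factor[OF regular_star[OF assms]] by (auto simp: star_star)
  define q where "q = c\<^sup>\<star> * a"
  define p where "p = a * d"
  have c': "a\<^sup>\<star> = c\<^sup>\<star> * a * a\<^sup>\<star>"
    using arg_cong[OF c, of star] by (simp add: star_mult star_star mult.assoc)
  have d': "a = d\<^sup>\<star> * a\<^sup>\<star> * a"
    using arg_cong[OF d, of star] by (simp add: star_mult star_star mult.assoc)
  have "q * q\<^sup>\<star> = q\<^sup>\<star>"
    unfolding q_def by (metis c' mult.assoc star_mult star_star)
  then have q: "q\<^sup>\<star> = q"
    by (metis star_mult star_star)
  have "p\<^sup>\<star> * p = p\<^sup>\<star>"
    unfolding p_def by (metis d mult.assoc star_mult)
  then have p: "p\<^sup>\<star> = p"
    by (metis star_mult star_star)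
  have aq: "a * q = a"
    using c' q by (metis q_def star_mult star_star)
  have pa: "p * a = a"
    using d' p by (metis p_def star_mult)
  have am: "a * (c\<^sup>\<star> * a * d) = p"
    using aq by (metis mult.assoc p_def q_def)
  have ma: "c\<^sup>\<star> * a * d * a = q"
    using pa by (metis mult.assoc p_def q_def)
  have "q * (c\<^sup>\<star> * a * d) = c\<^sup>\<star> * (p * a) * d"
    using am pa aq by (metis (no_types, lifting) mult.assoc q_def)
  then have "c\<^sup>\<star> * a * d * a * (c\<^sup>\<star> * a * d) = c\<^sup>\<star> * a * d"
    using ma pa by simp
  with am ma p q aq pa show thesis
    using that[of "c\<^sup>\<star> * a * d"] by simp
qed

text \<open>Upper semicontinuity: a \<open>y\<close> witnessing the inequality at \<open>a\<close>
  serves for all nearby \<open>b\<close>.\<close>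

lemma eventually_conorm_less:
  fixes a :: "'a::cstar_algebra"
  assumes "conorm a < c"
  shows "\<forall>\<^sub>F b in nhds a. conorm b < c"
proof -
  obtain y where y: "a\<^sup>\<star> * y \<noteq> 0" "ennreal (norm (a * (a\<^sup>\<star> * y)) / norm (a\<^sup>\<star> * y)) < c"
    using conorm_less_imp[OF assms] by blast
  have star: "((\<lambda>b. b\<^sup>\<star> * y) \<longlongrightarrow> a\<^sup>\<star> * y) (nhds a)"
    by (intro tendsto_intros bounded_linear.tendsto[OF bounded_linear_star] filterlim_ident)
  have "((\<lambda>b. ennreal (norm (b * (b\<^sup>\<star> * y)) / norm (b\<^sup>\<star> * y)))
      \<longlongrightarrow> ennreal (norm (a * (a\<^sup>\<star> * y)) / norm (a\<^sup>\<star> * y))) (nhds a)"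
    using y(1) by (intro tendsto_intros tendsto_ennrealI star filterlim_ident) auto
  then have "\<forall>\<^sub>F b in nhds a. ennreal (norm (b * (b\<^sup>\<star> * y)) / norm (b\<^sup>\<star> * y)) < c"
    using y(2) by (rule order_tendstoD)
  moreover have "\<forall>\<^sub>F b in nhds a. b\<^sup>\<star> * y \<noteq> 0"
    using tendsto_imp_eventually_ne[OF star y(1)] .
  ultimately show ?thesis
    by eventually_elim (use conorm_le in \<open>blast intro: le_less_trans\<close>)
qed

lemma conorm_le_moore_penrose:
  fixes a m :: "'a::cstar_algebra"
  assumes "m \<noteq> 0" and mam: "m * a * m = m"
    and am: "(a * m)\<^sup>\<star> = a * m" and ma: "(m * a)\<^sup>\<star> = m * a"
  shows "conorm a \<le> ennreal (1 / norm m)"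
proof -
  \<comment> \<open>Makes \<open>a\<^sup>\<star> * y\<close> equal to
    \<open>m * m\<^sup>\<star>\<close>, of norm \<open>(norm m)\<^sup>2\<close>. Its image
    \<open>a * m * m\<^sup>\<star>\<close> has norm at most \<open>norm m\<close>, since
    \<open>a * m\<close> is a projection.\<close>
  define y where "y = m\<^sup>\<star> * (m * m\<^sup>\<star>)"
  have "a\<^sup>\<star> * m\<^sup>\<star> * m = m"
    using ma mam by (simp add: star_mult)
  then have y: "a\<^sup>\<star> * y = m * m\<^sup>\<star>"
    by (simp add: y_def flip: mult.assoc)
  have nm: "norm (m * m\<^sup>\<star>) = (norm m)\<^sup>2"
    by (rule norm_mult_star_self)
  have "norm (a * m) = (norm (a * m))\<^sup>2"
    using norm_square_selfadjoint[OF am] mam by (simp add: mult.assoc)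
  then have "norm (a * m) \<le> 1"
    by (cases "norm (a * m) = 0") (simp_all add: power2_eq_square)
  then have "norm (a * (m * m\<^sup>\<star>)) \<le> norm m"
    using norm_mult_ineq[of "a * m" "m\<^sup>\<star>"] mult_right_mono[of "norm (a * m)" 1 "norm m"]
    by (simp add: norm_star mult.assoc)
  then have "norm (a * (a\<^sup>\<star> * y)) / norm (a\<^sup>\<star> * y) \<le> 1 / norm m"
    using \<open>m \<noteq> 0\<close> by (simp add: y nm power2_eq_square field_simps)
  moreover have "a\<^sup>\<star> * y \<noteq> 0"
    using nm \<open>m \<noteq> 0\<close> by (auto simp: y)
  ultimately show ?thesis
    using conorm_le[of a y] by (meson ennreal_leI order_trans)
qed

section \<open>Quasi-invertible elements and their perturbations\<close>

lemma quasi_invertible_iff_inner_inverse: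
  fixes a :: "'a::cstar_algebra"
  shows "quasi_invertible a \<longleftrightarrow>
    (\<exists>b. a * b * a = a \<and> (\<forall>z. z - a * b * z - z * b * a + a * b * z * b * a = 0))"
proof
  assume "quasi_invertible a"
  then obtain y where y: "z - a * y\<^sup>\<star> * z - z * y\<^sup>\<star> * a + a * y\<^sup>\<star> * z * y\<^sup>\<star> * a = 0" for z
    unfolding quasi_invertible_def by blast
  define b where "b = y\<^sup>\<star>"
  \<comment> \<open>\<open>b\<close> itself need not be an inner inverse. Formally,
    \<open>1 - ac = (1 - ab)\<^sup>2\<close> and \<open>1 - ca = (1 - ba)\<^sup>2\<close>, so that
    \<open>a - a * c * a\<close> becomes \<open>D a\<close>.\<close>
  define c where "c = b + b - b * a * b"
  define D where "D z = z - a * b * z - z * b * a + a * b * z * b * a" for z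
  have D: "D z = 0" for z
    unfolding D_def b_def by (rule y)
  have "a - a * c * a = D a"
    by (simp add: c_def D_def algebra_simps)
  then have "a * c * a = a"
    by (simp add: D)
  moreover have "z - a * c * z - z * c * a + a * c * z * c * a
      = D z - a * b * D z - D z * b * a + a * b * D z * b * a" for z
    by (simp add: c_def D_def algebra_simps)
  ultimately show "\<exists>b. a * b * a = a \<and> (\<forall>z. z - a * b * z - z * b * a + a * b * z * b * a = 0)"
    by (intro exI[of _ c]) (simp add: D)
next
  assume "\<exists>b. a * b * a = a \<and> (\<forall>z. z - a * b * z - z * b * a + a * b * z * b * a = 0)"
  then show "quasi_invertible a"
    unfolding quasi_invertible_def by (metis star_star)
qed

text \<open>Formally, \<open>(1 - am)(1 - ab) = 1 - am\<close> and
  \<open>(1 - ba)(1 - ma) = 1 - ma\<close>, so the outer factors for \<open>m\<close> absorb those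
  for \<open>b\<close>.\<close>

lemma inner_inverse_independent:
  fixes a :: "'a::ring"
  assumes aba: "a * b * a = a" and D: "\<And>z. z - a * b * z - z * b * a + a * b * z * b * a = 0"
    and ama: "a * m * a = a"
  shows "z - a * m * z - z * m * a + a * m * z * m * a = 0"
proof -
  define D where "D = z - a * b * z - z * b * a + a * b * z * b * a"
  have left: "a * (b * (a * x)) = a * x" "a * (m * (a * x)) = a * x" for x
    using aba ama by (simp_all flip: mult.assoc)
  have right: "a * (b * a) = a" "a * (m * a) = a"
    using aba ama by (simp_all add: mult.assoc)
  have "z - a * m * z - z * m * a + a * m * z * m * a = D - a * m * D - D * m * a + a * m * D * m * a"
    by (simp add: D_def left_diff_distrib right_diff_distrib distrib_left distrib_right mult.assoc
        left right)
  moreover have "D = 0"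
    unfolding D_def by (rule D)
  ultimately show ?thesis by simp
qed

text \<open>Here \<open>f = (1 + md)\<^sup>-\<^sup>1m = m(1 + dm)\<^sup>-\<^sup>1\<close>. With \<open>z = (1 + dm)\<^sup>-\<^sup>1(a + d)(1 + md)\<^sup>-\<^sup>1\<close> one has
  \<open>(a + d) - (a + d)f(a + d) = (1 - am)z(1 - ma)\<close>.\<close>

lemma perturbed_inner_inverse:
  fixes a :: "'a::{real_normed_algebra,banach}"
  assumes ama: "a * m * a = a" and mam: "m * a * m = m"
    and D: "\<And>z. z - a * m * z - z * m * a + a * m * z * m * a = 0"
    and small: "norm m * norm d < 1"
  obtains f where "(a + d) * f * (a + d) = a + d" "norm f * (1 - norm m * norm d) \<le> norm m"
proof -
  let ?c = "norm m * norm d" and ?b = "a + d"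
  have left: "\<exists>x. x + k * x = w" and right: "\<exists>x. x + x * k = w" if "norm k \<le> ?c" for k w :: 'a
  proof -
    have "norm (k * x) \<le> ?c * norm x" "norm (x * k) \<le> ?c * norm x" for x
      using norm_mult_ineq[of k x] norm_mult_ineq[of x k] mult_right_mono[OF that, of "norm x"]
      by (simp_all add: mult.commute)
    then show "\<exists>x. x + k * x = w" "\<exists>x. x + x * k = w"
      using small bounded_linear.linear[OF bounded_linear_mult_right]
        bounded_linear.linear[OF bounded_linear_mult_left]
      by (intro ex1_implies_ex[OF identity_plus_contraction[of _ ?c]]; simp)+
  qed
  have md: "norm (m * d) \<le> ?c" and dm: "norm (d * m) \<le> ?c"
    using norm_mult_ineq[of m d] norm_mult_ineq[of d m] by (simp_all add: mult.commute)
  obtain f where f: "f + m * d * f = m"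
    using left[OF md] by blast
  obtain e where e: "e + e * (d * m) = m"
    using right[OF dm] by blast
  \<comment> \<open>Evaluating \<open>e(d + dmd)f\<close> in two ways identifies the left and right
    solutions \<open>f\<close> and \<open>e\<close>.\<close>
  have "e * d * (f + m * d * f) = e * d * m" "(e + e * (d * m)) * d * f = m * d * f"
    by (simp_all add: f e)
  then have "e * (d * m) = m * d * f"
    by (simp add: algebra_simps)
  then have "e = f"
    using e f by (metis add_right_imp_eq)
  with e have f': "f + f * d * m = m"
    by (simp add: mult.assoc)
  obtain y where y: "y + d * m * y = ?b"
    using left[OF dm] by blast
  obtain z where z: "z + z * (m * d) = y"
    using right[OF md] by blast
  have "f * ?b = (f + f * d * m) * y"
    unfolding y[symmetric] by (simp add: algebra_simps)
  then have fb: "f * ?b = m * (z + z * (m * d))"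
    by (simp add: f' z)
  have b: "?b = (z + d * m * z) + (z + d * m * z) * (m * d)"
    unfolding y[symmetric] z[symmetric] by (simp add: algebra_simps)
  have "?b * f = (z + d * m * z) * (f + m * d * f)"
    unfolding b by (simp add: algebra_simps)
  then have bf: "?b * f = (z + d * m * z) * m"
    by (simp add: f)
  have fbf: "f * ?b * f = m * z * m"
  proof -
    have "f * ?b * f = m * z * (f + m * d * f)"
      unfolding fb by (simp add: algebra_simps)
    then show ?thesis by (simp add: f)
  qed
  \<comment> \<open>The left side is \<open>(1 - am)z(1 - ma)\<close> with \<open>a = x - d\<close>.
    For free \<open>x\<close> this is a polynomial identity; at \<open>x = a + d\<close> its
    products fold back into \<open>f\<close>.\<close>
  have "z - (x - d) * m * z - z * m * (x - d) + (x - d) * m * z * m * (x - d)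
      = (z + d * m * z) + (z + d * m * z) * (m * d) - (z + d * m * z) * m * x
        - x * (m * (z + z * (m * d))) + x * (m * z * m) * x" for x
    by (simp add: algebra_simps)
  from this[of ?b] have *: "?b - ?b * f * ?b - ?b * (f * ?b) + ?b * (f * ?b * f) * ?b = 0"
    unfolding b[symmetric] bf[symmetric] fb[symmetric] fbf[symmetric] by (simp add: D)
  \<comment> \<open>Collapses \<open>*\<close> to \<open>?b - ?b * f * ?b = 0\<close>.\<close>
  have "f * ?b * f = f"
  proof -
    have mdf: "m * d * f = m - f" and fdm: "f * d * m = m - f"
      using f f' by (simp_all add: algebra_simps)
    have "f * a * f = (m - f * d * m) * a * (m - m * d * f)"
      by (simp add: mdf fdm)
    also have "\<dots> = m * a * m - (m * a * m) * d * f - f * d * (m * a * m) + f * d * (m * a * m) * d * f"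
      by (simp add: algebra_simps)
    also have "\<dots> = m - m * d * f - f * d * m + f * d * (m * d * f)"
      by (simp only: mam) (simp add: mult.assoc)
    also have "\<dots> = f - f * d * f"
      by (simp add: mdf fdm right_diff_distrib)
    finally show ?thesis
      by (simp add: algebra_simps)
  qed
  with * have "?b - ?b * f * ?b - ?b * (f * ?b) + ?b * f * ?b = 0"
    by simp
  then have inner: "?b * f * ?b = ?b"
    by (simp add: mult.assoc)
  have "norm f \<le> norm m + ?c * norm f"
  proof -
    have "f = m - m * d * f"
      using f by (simp add: algebra_simps)
    then have "norm f \<le> norm m + norm (m * d * f)"
      by (metis norm_triangle_ineq4)
    also have "norm (m * d * f) \<le> ?c * norm f"
      using norm_mult_ineq[of "m * d" f] mult_right_mono[OF md, of "norm f"] by simp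
    finally show ?thesis by simp
  qed
  then have "norm f * (1 - ?c) \<le> norm m"
    by (simp add: algebra_simps)
  with inner show thesis
    by (rule that)
qed

text \<open>The bound is the reciprocal of \<open>norm m / (1 - norm m * dist b a)\<close>, which
  dominates the norm of an inner inverse of \<open>b\<close>. Far from \<open>a\<close> it is
  trivial, as \<open>ennreal\<close> sends negative reals to 0.\<close>

lemma conorm_perturbation:
  fixes a :: "'a::cstar_algebra"
  assumes ama: "a * m * a = a" and mam: "m * a * m = m" and "m \<noteq> 0"
    and D: "\<And>z. z - a * m * z - z * m * a + a * m * z * m * a = 0"
  shows "ennreal (1 / norm m - dist b a) \<le> conorm b"
proof (cases "norm m * dist b a < 1")
  case True
  then obtain f where f: "(a + (b - a)) * f * (a + (b - a)) = a + (b - a)"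
    "norm f * (1 - norm m * dist b a) \<le> norm m"
    using perturbed_inner_inverse[OF ama mam D, of "b - a"] by (auto simp: dist_norm)
  let ?M = "norm m / (1 - norm m * dist b a)"
  have "ennreal (1 / ?M) \<le> conorm b"
    using f True \<open>m \<noteq> 0\<close> by (intro conorm_ge_inner_inverse[of b f]) (simp_all add: field_simps)
  also have "1 / ?M = 1 / norm m - dist b a"
    using \<open>m \<noteq> 0\<close> by (simp add: field_simps)
  finally show ?thesis .
next
  case False
  with \<open>m \<noteq> 0\<close> have "1 / norm m - dist b a \<le> 0"
    by (simp add: field_simps)
  then show ?thesis
    by (simp add: ennreal_neg)
qed

section \<open>Points of continuity\<close>

lemma isCont_conorm_quasi_invertible:
  fixes a :: "'a::cstar_algebra"
  assumes "quasi_invertible a"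
  shows "isCont conorm a"
proof -
  obtain b where b: "a * b * a = a" "\<And>z. z - a * b * z - z * b * a + a * b * z * b * a = 0"
    using assms unfolding quasi_invertible_iff_inner_inverse by blast
  then have "von_neumann_regular a"
    by (auto simp: von_neumann_regular_def)
  then obtain m where m: "a * m * a = a" "m * a * m = m" "(a * m)\<^sup>\<star> = a * m" "(m * a)\<^sup>\<star> = m * a"
    by (rule moore_penrose_inverse)
  have D: "z - a * m * z - z * m * a + a * m * z * m * a = 0" for z
    by (rule inner_inverse_independent[OF b m(1)])
  show ?thesis
  proof (cases "m = 0")
    case True
    \<comment> \<open>For \<open>m = 0\<close> the identity \<open>D\<close> reads
      \<open>z = 0\<close>, so the algebra is trivial.\<close>
    with D have "z = 0" for z :: 'a by simp
    then have eq: "x = a" for x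
      by (metis (full_types))
    have const: "(\<lambda>_. conorm a) = (conorm :: 'a \<Rightarrow> ennreal)"
      by (rule ext) (subst eq, rule refl)
    have "isCont (\<lambda>_ :: 'a. conorm a) a"
      by simp
    then show ?thesis
      unfolding const .
  next
    case False
    show ?thesis
      unfolding isCont_def
    proof (rule order_tendstoI)
      \<comment> \<open>The perturbation bound tends to \<open>1 / norm m\<close>, which is at least
        \<open>conorm a\<close>.\<close>
      fix c assume "c < conorm a"
      also have "conorm a \<le> ennreal (1 / norm m)"
        by (rule conorm_le_moore_penrose[OF False m(2-4)])
      finally have "c < ennreal (1 / norm m)" .
      moreover have "((\<lambda>b. ennreal (1 / norm m - dist b a)) \<longlongrightarrow> ennreal (1 / norm m - dist a a)) (at a)"
        by (intro tendsto_ennrealI tendsto_intros)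
      ultimately have "\<forall>\<^sub>F b in at a. c < ennreal (1 / norm m - dist b a)"
        by (intro order_tendstoD) simp_all
      then show "\<forall>\<^sub>F b in at a. c < conorm b"
        by eventually_elim (use conorm_perturbation[OF m(1,2) False D] in \<open>blast intro: less_le_trans\<close>)
    next
      fix c assume "conorm a < c"
      then show "\<forall>\<^sub>F b in at a. conorm b < c"
        using eventually_conorm_less by (auto simp: at_within_def intro: filter_leD[OF inf_le1])
    qed
  qed
qed

text \<open>Nothing lies below the value 0, so upper semicontinuity suffices.\<close>

lemma isCont_conorm_not_regular:
  fixes a :: "'a::cstar_algebra"
  assumes "\<not> von_neumann_regular a"
  shows "isCont conorm a"
proof -
  have "conorm a = 0"
    using assms by (simp flip: conorm_pos_iff_regular)
  then show ?thesis
    unfolding isCont_def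
    using eventually_conorm_less[of a]
    by (intro order_tendstoI) (auto simp: at_within_def intro: filter_leD[OF inf_le1])
qed

text \<open>For \<open>w = (1 - am)z(1 - ma)\<close> the elements \<open>a\<close> and \<open>\<epsilon>w\<close> have orthogonal supports and
  orthogonal ranges, so that the conorm of \<open>a + \<epsilon>w\<close> is at most that of \<open>\<epsilon>w\<close>.\<close>

lemma isCont_conorm_regular_imp_quasi_invertible:
  fixes a :: "'a::cstar_algebra"
  assumes cont: "isCont conorm a" and reg: "von_neumann_regular a"
  shows "quasi_invertible a"
proof (rule ccontr)
  assume not_qi: "\<not> quasi_invertible a"
  obtain m where m: "a * m * a = a" "m * a * m = m" "(a * m)\<^sup>\<star> = a * m" "(m * a)\<^sup>\<star> = m * a"
    using reg by (rule moore_penrose_inverse)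
  with not_qi obtain z where z: "z - a * m * z - z * m * a + a * m * z * m * a \<noteq> 0"
    unfolding quasi_invertible_iff_inner_inverse by blast
  define w where "w = z - a * m * z - z * m * a + a * m * z * m * a"
  have "w * m * a = 0"
    using m(1) unfolding w_def
    by (simp add: left_diff_distrib distrib_right mult.assoc)
  \<comment> \<open>\<open>m * a\<close> is the support projection of \<open>a\<close>, so it fixes
    \<open>a\<^sup>\<star>\<close> from the left.\<close>
  moreover have "m * a * a\<^sup>\<star> = a\<^sup>\<star>"
    using m by (metis star_mult mult.assoc)
  ultimately have "w * a\<^sup>\<star> = 0"
    by (metis mult.assoc mult_zero_left)
  then have aw: "a * w\<^sup>\<star> = 0"
    by (metis star_mult star_star star_zero)
  have "a * m * w = 0"
    using m(1) unfolding w_def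
    by (simp add: right_diff_distrib distrib_left flip: mult.assoc)
  moreover have "a\<^sup>\<star> * (a * m) = a\<^sup>\<star>"
    using m by (metis star_mult mult.assoc)
  ultimately have wa: "a\<^sup>\<star> * w = 0"
    by (metis mult.assoc mult_zero_right)
  \<comment> \<open>Taking \<open>y = w\<close> gives the test vector
    \<open>e *\<^sub>R (w\<^sup>\<star> * w)\<close>, which \<open>a\<close> annihilates, so only
    \<open>e *\<^sub>R w\<close> acts on it.\<close>
  have le: "conorm (a + e *\<^sub>R w) \<le> ennreal (e * norm w)" if "e > 0" for e
  proof -
    have 1: "(a + e *\<^sub>R w)\<^sup>\<star> * w = e *\<^sub>R (w\<^sup>\<star> * w)"
      by (simp add: star_add star_scaleR distrib_right wa)
    have 2: "norm (w\<^sup>\<star> * w) \<noteq> 0"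
      using z by (simp add: norm_star_mult_self w_def)
    have "(a + e *\<^sub>R w) * (e *\<^sub>R (w\<^sup>\<star> * w)) = (e * e) *\<^sub>R (w * (w\<^sup>\<star> * w))"
      using aw by (simp add: distrib_right) (simp flip: mult.assoc)
    then have "norm ((a + e *\<^sub>R w) * (e *\<^sub>R (w\<^sup>\<star> * w))) / norm (e *\<^sub>R (w\<^sup>\<star> * w)) \<le> e * norm w"
      using \<open>e > 0\<close> 2 norm_mult_ineq[of w "w\<^sup>\<star> * w"] by (simp add: field_simps)
    then show ?thesis
      using conorm_le[of "a + e *\<^sub>R w" w] 1 2 \<open>e > 0\<close> by (auto intro: order_trans ennreal_leI)
  qed
  have "((\<lambda>e. a + e *\<^sub>R w) \<longlongrightarrow> a + 0 *\<^sub>R w) (at_right 0)"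
    by (intro tendsto_intros)
  then have "((\<lambda>e. conorm (a + e *\<^sub>R w)) \<longlongrightarrow> conorm a) (at_right 0)"
    using isCont_tendsto_compose[OF cont] by simp
  moreover have "((\<lambda>e. ennreal (e * norm w)) \<longlongrightarrow> ennreal (0 * norm w)) (at_right 0)"
    by (intro tendsto_ennrealI tendsto_intros)
  moreover have "\<forall>\<^sub>F e in at_right 0. conorm (a + e *\<^sub>R w) \<le> ennreal (e * norm w)"
    using le by (auto simp: eventually_at_filter)
  ultimately have "conorm a \<le> ennreal (0 * norm w)"
    by (intro tendsto_le[OF trivial_limit_at_right_real])
  then have "conorm a = 0" by simp
  with reg show False
    by (simp flip: conorm_pos_iff_regular)
qed

theorem corollary3p7:
  fixes a :: "'a::cstar_algebra"
  assumes "extremally_rich TYPE('a)"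
  shows "isCont conorm a \<longleftrightarrow> \<not> von_neumann_regular a \<or> quasi_invertible a"
  using isCont_conorm_quasi_invertible isCont_conorm_not_regular
    isCont_conorm_regular_imp_quasi_invertible by blast

end
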